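(* Let $X=(X_1,\dots,X_p)$ be a random vector, let $Y=f(X)$ be square-integrable with $\mathrm{Var}(Y)\neq 0$, and let $\mathcal{C}=\{C_1,\dots,C_k\}$ be a partition of $[1:p]$ such that the groups of random variables $A_1=X_{C_1},\dots,A_k=X_{C_k}$ are independent. Write $Y=g(A_1,\dots,A_k)$ with Hoeffding decomposition $g(A)=\sum_{w\subseteq[1:k]}g_w(A_w)$. For $i\in[1:p]$ let $j(i)\in[1:k]$ be the index such that $i\in C_{j(i)}$. Then for all $i\in[1:p]$, the Shapley effect $\eta_i$ of $X_i$ for the output $Y$ satisfies $$\eta_i=\sum_{\substack{w\subseteq[1:k],\\ j(i)\in w}}S_w^g\,\eta_i^{g,w},$$ where $S_w^g$ is the Sobol index of $g$ for the group of inputs $A_w$ and $\eta_i^{g,w}$ is the Shapley effect of $X_i$ for the output $g_w(A_w)$.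
   Context: Let $(\Omega,\mathcal{A},\mathbb{P})$ be a probability space, let $E=\times_{i=1}^pE_i$ be a product of measurable spaces $(E_i,\mathcal{E}_i)$ with the product $\sigma$-algebra $\mathcal{E}=\otimes_{i=1}^p\mathcal{E}_i$, and let $X=(X_1,\dots,X_p):\Omega\to E$ be a random variable. Let $f:(E,\mathcal{E})\to(\mathbb{R},\mathcal{B}(\mathbb{R}))$ be measurable with $f(X)\in L^2$; $Y:=f(X)$, and $\mathrm{Var}(Y)\neq0$ is assumed. $[1:p]$ is the set of integers from $1$ to $p$, $-i:=[1:p]\setminus\{i\}$, and $|u|$ is the cardinality of $u$. For $u\subseteq[1:p]$, $x_u:=(x_i)_{i\in u}$; conditioning on $X_\emptyset$ is trivial conditioning, i.e. $\mathrm{E}(\cdot\mid X_\emptyset)=\mathrm{E}(\cdot)$. Put $V_u:=\mathrm{Var}(\mathrm{E}(Y\mid X_u))$. The Shapley effects of $Y$ are $$\eta_i:=\frac{1}{p\,\mathrm{Var}(Y)}\sum_{u\subseteq -i}\binom{p-1}{|u|}^{-1}\left(V_{u\cup\{i\}}-V_u\right),\qquad i\in[1:p].$$ The (nonempty, disjoint) sets $C_1,\dots,C_k$ partition $[1:p]$; $A_j:=X_{C_j}$, $A:=(A_1,\dots,A_k)$, and for $w\subseteq[1:k]$, $A_w:=(A_j)_{j\in w}$ and $C_w:=\bigcup_{j\in w}C_j$. The function $g$ is $f$ viewed as a function of the groups: $f(X_1,\dots,X_p)=g(A_1,\dots,A_k)$. The Hoeffding decomposition of $g$ is the (almost surely unique)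 decomposition $g(A)=\sum_{w\subseteq[1:k]}g_w(A_w)$ with $g_w(A_w)\in L^2$ and $\mathrm{E}(g_w(A_w)\mid A_z)=0$ for every $z\subseteq[1:k]$ with $w\not\subseteq z$ (so $g_\emptyset=\mathrm{E}(Y)$). The Sobol indices of $g$ are $$S_w^g:=\frac{\mathrm{Var}(g_w(A_w))}{\mathrm{Var}(Y)}=\frac{1}{\mathrm{Var}(Y)}\sum_{z\subseteq w}(-1)^{|w|-|z|}V_z^g,\qquad V_z^g:=\mathrm{Var}(\mathrm{E}(Y\mid A_z)).$$ Put $V_u^{g,w}:=\mathrm{Var}(\mathrm{E}(g_w(A_w)\mid X_u))$, and for $i\in C_w$, $$\eta_i^{g,w}:=\frac{1}{|C_w|\,\mathrm{Var}(g_w(A_w))}\sum_{u\subseteq C_w\setminus\{i\}}\binom{|C_w|-1}{|u|}^{-1}\left(V_{u\cup\{i\}}^{g,w}-V_u^{g,w}\right).$$ Convention: when $\mathrm{Var}(g_w(A_w))=0$ (so that $S_w^g=0$ and $\eta_i^{g,w}$ is not defined), the product $S_w^g\eta_i^{g,w}$ is taken to be $0$. *)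

theory Defs
  imports "HOL-Probability.Probability"
begin

text \<open>
  A family of random variables \<open>X i\<close> with values in \<open>E i\<close> is given by a family of measurable spaces
  \<open>E\<close> over one carrier type. The spaces \<open>E i\<close> may have different underlying sets and
  sigma-algebras; heterogeneous carriers are to be embedded in a common (sum) type.
\<close>

definition subvec :: "('i \<Rightarrow> 'a \<Rightarrow> 'e) \<Rightarrow> 'i set \<Rightarrow> 'a \<Rightarrow> 'i \<Rightarrow> 'e" where
  "subvec X u \<omega> = (\<lambda>i\<in>u. X i \<omega>)"

definition sigma_subvec ::
    "'a measure \<Rightarrow> ('i \<Rightarrow> 'e measure) \<Rightarrow> ('i \<Rightarrow> 'a \<Rightarrow> 'e) \<Rightarrow> 'i set \<Rightarrow> 'a measure" where
  "sigma_subvec M E X u = vimage_algebra (space M) (subvec X u) (PiM u E)"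

text \<open>
  For \<open>u = {}\<close> the generated sigma-algebra is trivial, so that conditioning on the empty
  subvector is trivial conditioning.
\<close>

lemma sets_sigma_subvec_empty: "sets (sigma_subvec M E X {}) = {{}, space M}"
proof -
  have "subvec X {} = (\<lambda>\<omega>. \<lambda>_. undefined)"
    by (intro ext) (simp add: subvec_def)
  moreover have "sets (PiM {} E) = {{}, {\<lambda>_. undefined}}"
    by (auto simp: PiM_empty)
  ultimately show ?thesis
    unfolding sigma_subvec_def by (subst sets_vimage_algebra2) (auto simp: space_PiM)
qed

definition cond_exp_given ::
    "'a measure \<Rightarrow> ('i \<Rightarrow> 'e measure) \<Rightarrow> ('i \<Rightarrow> 'a \<Rightarrow> 'e) \<Rightarrow> 'i set \<Rightarrow> ('a \<Rightarrow> real) \<Rightarrow> 'a \<Rightarrow> real"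
where
  "cond_exp_given M E X u Z = real_cond_exp M (sigma_subvec M E X u) Z"

definition cond_exp_variance ::
    "'a measure \<Rightarrow> ('i \<Rightarrow> 'e measure) \<Rightarrow> ('i \<Rightarrow> 'a \<Rightarrow> 'e) \<Rightarrow> ('a \<Rightarrow> real) \<Rightarrow> 'i set \<Rightarrow> real"
where
  "cond_exp_variance M E X Z u = prob_space.variance M (cond_exp_given M E X u Z)"

text \<open>
  Shapley effect of the input \<open>X i\<close> for the output \<open>Z\<close>, where the inputs are \<open>(X i)\<^sub>i\<^sub>\<in>\<^sub>D\<close>.
  If \<open>Z\<close> has variance zero, the value is the conventional \<open>0\<close>.
\<close>

definition shapley_effect ::
    "'a measure \<Rightarrow> ('i \<Rightarrow> 'e measure) \<Rightarrow> ('i \<Rightarrow> 'a \<Rightarrow> 'e) \<Rightarrow> 'i set \<Rightarrow> ('a \<Rightarrow> real) \<Rightarrow> 'i \<Rightarrow> real"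
where
  "shapley_effect M E X D Z i =
     1 / (real (card D) * prob_space.variance M Z) *
     (\<Sum>u\<in>Pow (D - {i}).
        inverse (real ((card D - 1) choose card u)) *
        (cond_exp_variance M E X Z (u \<union> {i}) - cond_exp_variance M E X Z u))"

definition hoeffding_decomposition ::
    "'a measure \<Rightarrow> 'j set \<Rightarrow> ('j \<Rightarrow> 'b measure) \<Rightarrow> ('j \<Rightarrow> 'a \<Rightarrow> 'b) \<Rightarrow> (('j \<Rightarrow> 'b) \<Rightarrow> real)
      \<Rightarrow> ('j set \<Rightarrow> ('j \<Rightarrow> 'b) \<Rightarrow> real) \<Rightarrow> bool"
where
  "hoeffding_decomposition M J F A g h \<longleftrightarrow>
     (\<forall>w. w \<subseteq> J \<longrightarrow>
        h w \<in> borel_measurable (PiM w F) \<and>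
        integrable M (\<lambda>\<omega>. (h w (subvec A w \<omega>))\<^sup>2) \<and>
        (\<forall>z. z \<subseteq> J \<and> \<not> w \<subseteq> z \<longrightarrow>
           (AE \<omega> in M. cond_exp_given M F A z (\<lambda>\<omega>. h w (subvec A w \<omega>)) \<omega> = 0))) \<and>
     (AE \<omega> in M. g (subvec A J \<omega>) = (\<Sum>w\<in>Pow J. h w (subvec A w \<omega>)))"

definition sobol_index :: "'a measure \<Rightarrow> ('a \<Rightarrow> real) \<Rightarrow> ('a \<Rightarrow> real) \<Rightarrow> real" where
  "sobol_index M Y Z = prob_space.variance M Z / prob_space.variance M Y"

definition group_index :: "nat \<Rightarrow> (nat \<Rightarrow> nat set) \<Rightarrow> nat \<Rightarrow> nat" where
  "group_index k C i = (THE j. j \<in> {1..k} \<and> i \<in> C j)"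

lemma group_index_eq:
  assumes "disjoint_family_on C {1..k}" "j \<in> {1..k}" "i \<in> C j"
  shows "group_index k C i = j"
  unfolding group_index_def
proof (rule the_equality)
  show "j \<in> {1..k} \<and> i \<in> C j"
    using assms by simp
  show "l = j" if "l \<in> {1..k} \<and> i \<in> C l" for l
    using assms that unfolding disjoint_family_on_def by blast
qed

definition group_space ::
    "(nat \<Rightarrow> nat set) \<Rightarrow> (nat \<Rightarrow> 'e measure) \<Rightarrow> nat \<Rightarrow> (nat \<Rightarrow> 'e) measure" where
  "group_space C E j = PiM (C j) E"

definition group_vec ::
    "(nat \<Rightarrow> nat set) \<Rightarrow> (nat \<Rightarrow> 'a \<Rightarrow> 'e) \<Rightarrow> nat \<Rightarrow> 'a \<Rightarrow> nat \<Rightarrow> 'e" where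
  "group_vec C X j = subvec X (C j)"

text \<open>The function \<open>f\<close> of \<open>p\<close> variables viewed as a function of the \<open>k\<close> groups of variables.\<close>

definition group_fun ::
    "nat \<Rightarrow> nat \<Rightarrow> (nat \<Rightarrow> nat set) \<Rightarrow> ((nat \<Rightarrow> 'e) \<Rightarrow> real) \<Rightarrow> (nat \<Rightarrow> nat \<Rightarrow> 'e) \<Rightarrow> real" where
  "group_fun p k C f a = f (\<lambda>i\<in>{1..p}. a (group_index k C i) i)"

lemma group_fun_group_vec:
  assumes "disjoint_family_on C {1..k}" "(\<Union>j\<in>{1..k}. C j) = {1..p}"
  shows "group_fun p k C f (subvec (group_vec C X) {1..k} \<omega>) = f (subvec X {1..p} \<omega>)"
proof -
  have "subvec (group_vec C X) {1..k} \<omega> (group_index k C i) i = X i \<omega>" if i: "i \<in> {1..p}" for i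
  proof -
    from i assms(2) obtain j where j: "j \<in> {1..k}" "i \<in> C j" by blast
    then show ?thesis
      using group_index_eq[OF assms(1) j] by (simp add: subvec_def group_vec_def)
  qed
  then show ?thesis
    unfolding group_fun_def by (intro arg_cong[where f = f]) (auto simp: subvec_def[of X])
qed

end

theory Submission
  imports Defs
begin

text \<open>
  For a set \<open>u\<close> of inputs let \<open>V u = Var (E (Y | X\<^sub>u))\<close>, and let \<open>V\<^sub>w u = Var (E (Z\<^sub>w | X\<^sub>u))\<close> for the
  component \<open>Z\<^sub>w\<close> of the Hoeffding decomposition, a function of the groups in \<open>w\<close>. The Shapley effect
  of \<open>X\<^sub>i\<close>, multiplied by the variance of the output, is the Shapley value of player \<open>i\<close> in the game
  with worth \<open>V\<close> or \<open>V\<^sub>w\<close>. Since \<open>Var Y\<close> times the Sobol index is \<open>Var Z\<^sub>w\<close>, the claim says that the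
  Shapley value of the game \<open>V\<close> on all inputs is the sum of the Shapley values of the games \<open>V\<^sub>w\<close>,
  each played only by the inputs in the groups \<open>w\<close>.

  Three facts imply this. The first is \<open>V u = (\<Sum>w. V\<^sub>w u)\<close> for every \<open>u\<close>, even if \<open>u\<close> cuts through
  groups (\<open>cond_exp_variance_hoeffding_sum\<close>). It holds because the variables \<open>E (Z\<^sub>w | X\<^sub>u)\<close> remain
  uncorrelated. The second is that \<open>V\<^sub>w u\<close> depends only on the inputs in \<open>u\<close> that belong to the groups
  \<open>w\<close> (\<open>cond_exp_variance_restrict_groups\<close>), since all other inputs are independent of \<open>A\<^sub>w\<close>. Thus the
  inputs outside the groups \<open>w\<close> are dummy players of the game \<open>V\<^sub>w\<close>. The third is that the Shapley
  value is linear in the game, vanishes for a dummy player, and is unchanged for the other players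
  when dummies are removed (\<open>shapley_value_carrier\<close>). By linearity the value for \<open>V\<close> is the sum of the
  values for all the \<open>V\<^sub>w\<close>. Components not involving the group of \<open>i\<close> drop out, and in the others the
  players can be restricted to the groups \<open>w\<close>.

  The second fact also drives the first. It makes \<open>E (Z\<^sub>w | X\<^sub>u)\<close> a function of \<open>A\<^sub>w\<close>, and the defining
  property of the Hoeffding decomposition, \<open>E (Z\<^sub>w | A\<^sub>z) = 0\<close> unless \<open>w \<subseteq> z\<close>, then yields
  orthogonality (\<open>expectation_cond_exp_orthogonal\<close>).
\<close>

section \<open>The Shapley value of a cooperative game\<close>

text \<open>
  The Shapley value of player \<open>i\<close> in the cooperative game with player set \<open>D\<close> and worth function
  \<open>v\<close>. Apart from division by the variance, a Shapley effect is the Shapley value of the game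
  \<open>u \<mapsto> Var (E (Z | X\<^sub>u))\<close>. Leaving that division out keeps the value linear in \<open>v\<close> and meaningful
  when the variance is zero.
\<close>

definition shapley_value :: "'i set \<Rightarrow> ('i set \<Rightarrow> real) \<Rightarrow> 'i \<Rightarrow> real" where
  "shapley_value D v i =
     (\<Sum>u\<in>Pow (D - {i}). inverse (real ((card D - 1) choose card u)) * (v (u \<union> {i}) - v u))
     / real (card D)"

lemma shapley_effect_eq_shapley_value:
  "shapley_effect M E X D Z i =
     shapley_value D (cond_exp_variance M E X Z) i / prob_space.variance M Z"
  by (simp add: shapley_effect_def shapley_value_def)

lemma shapley_value_cong:
  assumes "i \<in> D" "\<And>u. u \<subseteq> D \<Longrightarrow> v u = v' u"
  shows "shapley_value D v i = shapley_value D v' i"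
proof -
  have "v (u \<union> {i}) - v u = v' (u \<union> {i}) - v' u" if "u \<in> Pow (D - {i})" for u
  proof -
    have "u \<subseteq> D" "u \<union> {i} \<subseteq> D"
      using that assms(1) by auto
    then show ?thesis
      using assms(2) by simp
  qed
  then show ?thesis
    by (simp add: shapley_value_def)
qed

lemma shapley_value_sum:
  "shapley_value D (\<lambda>u. \<Sum>w\<in>W. v w u) i = (\<Sum>w\<in>W. shapley_value D (v w) i)"
proof -
  have "(\<Sum>w\<in>W. shapley_value D (v w) i) =
    (\<Sum>w\<in>W. \<Sum>u\<in>Pow (D - {i}).
       inverse (real ((card D - 1) choose card u)) * (v w (u \<union> {i}) - v w u)) / real (card D)"
    by (simp add: shapley_value_def sum_divide_distrib)
  also have "\<dots> = shapley_value D (\<lambda>u. \<Sum>w\<in>W. v w u) i"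
    unfolding shapley_value_def
    by (subst sum.swap) (simp flip: sum_distrib_left sum_subtractf)
  finally show ?thesis ..
qed

lemma shapley_value_dummy:
  assumes "\<And>u. u \<subseteq> D - {i} \<Longrightarrow> v (u \<union> {i}) = v u"
  shows "shapley_value D v i = 0"
  using assms by (simp add: shapley_value_def)

lemma inverse_binomial_add_Suc:
  assumes "s < n"
  shows "inverse (real (n choose s)) + inverse (real (n choose Suc s)) =
    real (n + 1) / real n * inverse (real ((n - 1) choose s))"
proof -
  obtain d where n: "n = Suc (s + d)"
    using assms less_iff_Suc_add by auto
  have fact: "fact (Suc d) = (1 + real d) * fact d" "fact (Suc s) = (1 + real s) * fact s"
       "fact (Suc (s + d)) = (1 + real s + real d) * fact (s + d)"
    by (simp_all add: algebra_simps)
  have "real (n choose s) = fact (Suc (s + d)) / (fact s * fact (Suc d))"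
       "real (n choose Suc s) = fact (Suc (s + d)) / (fact (Suc s) * fact d)"
       "real ((n - 1) choose s) = fact (s + d) / (fact s * fact d)"
    unfolding n by (simp_all add: binomial_fact Suc_diff_le del: fact_Suc binomial_Suc_Suc)
  note binomials = this
  have *: "real n = 1 + real s + real d" "real (n + 1) = 2 + real s + real d"
    by (simp_all add: n)
  have identity: "inverse ((1 + r + t) * a / (b * ((1 + t) * c))) + inverse ((1 + r + t) * a / ((1 + r) * b * c)) =
      (2 + r + t) / (1 + r + t) * inverse (a / (b * c))"
    if "a > 0" "b > 0" "c > 0" "r \<ge> 0" "t \<ge> 0" for a b c r t :: real
    using that by (simp add: divide_simps) (simp add: algebra_simps)
  show ?thesis
    unfolding binomials fact * by (rule identity) auto
qed

text \<open>
  A coalition \<open>u\<close> of the smaller game and \<open>u\<close> joined by the dummy player \<open>x\<close> give player \<open>i\<close> the same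
  marginal contribution. So only their two weights have to be merged into the weight of \<open>u\<close> in the
  smaller game, which is what \<open>inverse_binomial_add_Suc\<close> does.
\<close>

lemma shapley_value_insert_dummy:
  assumes "finite D" "i \<in> D" "x \<notin> D" and dummy: "\<And>u. u \<subseteq> D \<Longrightarrow> v (insert x u) = v u"
  shows "shapley_value (insert x D) v i = shapley_value D v i"
proof -
  let ?U = "Pow (D - {i})" and ?n = "card D"
  let ?d = "\<lambda>u. v (u \<union> {i}) - v u"
  let ?c = "\<lambda>m s. inverse (real (m choose s))"
  have n: "?n > 0"
    using assms(1,2) card_gt_0_iff by auto
  have U: "insert x D - {i} = insert x (D - {i})"
    using assms(2,3) by auto
  have inj: "inj_on (insert x) ?U"
    using assms(3) by (auto simp: inj_on_def)
  have disj: "?U \<inter> insert x ` ?U = {}"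
    using assms(3) by auto
  have d: "?d (insert x u) = ?d u" if "u \<in> ?U" for u
  proof -
    have "u \<subseteq> D" "u \<union> {i} \<subseteq> D"
      using that assms(2) by auto
    then show ?thesis
      using dummy[of u] dummy[of "u \<union> {i}"] by (simp add: insert_commute)
  qed
  have c: "card (insert x u) = Suc (card u)" if "u \<in> ?U" for u
    using that assms(1,3) by (subst card_insert_disjoint) (auto intro: finite_subset)
  have s: "card u < ?n" if "u \<in> ?U" for u
    using that assms(1,2) by (intro psubset_card_mono) auto
  have "(\<Sum>u\<in>Pow (insert x D - {i}). ?c ?n (card u) * ?d u) =
        (\<Sum>u\<in>?U. ?c ?n (card u) * ?d u) + (\<Sum>u\<in>insert x ` ?U. ?c ?n (card u) * ?d u)"
    unfolding U Pow_insert using disj assms(1) by (intro sum.union_disjoint) auto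
  also have "(\<Sum>u\<in>insert x ` ?U. ?c ?n (card u) * ?d u) =
             (\<Sum>u\<in>?U. ?c ?n (Suc (card u)) * ?d u)"
    using d c by (subst sum.reindex[OF inj]) (auto intro!: sum.cong)
  also have "(\<Sum>u\<in>?U. ?c ?n (card u) * ?d u) + (\<Sum>u\<in>?U. ?c ?n (Suc (card u)) * ?d u) =
             (\<Sum>u\<in>?U. (?c ?n (card u) + ?c ?n (Suc (card u))) * ?d u)"
    by (simp add: sum.distrib distrib_right)
  also have "\<dots> = real (?n + 1) / real ?n * (\<Sum>u\<in>?U. ?c (?n - 1) (card u) * ?d u)"
    unfolding sum_distrib_left using s
    by (intro sum.cong) (auto simp: inverse_binomial_add_Suc)
  finally have "(\<Sum>u\<in>Pow (insert x D - {i}). ?c ?n (card u) * ?d u) / real (?n + 1) =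
      (\<Sum>u\<in>?U. ?c (?n - 1) (card u) * ?d u) / real ?n"
    by simp
  then show ?thesis
    using assms(1,3) by (simp add: shapley_value_def)
qed

text \<open>
  If the worth of a coalition depends only on its members in \<open>B\<close>, all other players are dummies and
  can be removed one at a time.
\<close>

lemma shapley_value_carrier:
  assumes "finite D" "B \<subseteq> D" "i \<in> B" and v: "\<And>u. u \<subseteq> D \<Longrightarrow> v u = v (u \<inter> B)"
  shows "shapley_value D v i = shapley_value B v i"
proof -
  have "shapley_value (B \<union> T) v i = shapley_value B v i" if "finite T" "T \<subseteq> D - B" for T
    using that
  proof (induction T rule: finite_induct)
    case (insert x T)
    have "v (insert x u) = v u" if "u \<subseteq> B \<union> T" for u
    proof -
      have "insert x u \<inter> B = u \<inter> B"
        using insert.prems by auto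
      moreover have "u \<subseteq> D" "insert x u \<subseteq> D"
        using that insert.prems assms(2) by auto
      ultimately show ?thesis
        using v[of u] v[of "insert x u"] by simp
    qed
    moreover have "finite (B \<union> T)" "x \<notin> B \<union> T" "i \<in> B \<union> T"
      using assms(1-3) insert by (auto intro: finite_subset)
    ultimately have "shapley_value (insert x (B \<union> T)) v i = shapley_value (B \<union> T) v i"
      by (intro shapley_value_insert_dummy)
    with insert show ?case
      by simp
  qed simp
  from this[of "D - B"] assms(1,2) show ?thesis
    by (simp add: Un_absorb1)
qed

section \<open>Conditional expectations and variances\<close>

lemma (in prob_space) sigma_finite_subalgebraI:
  "subalgebra M F \<Longrightarrow> sigma_finite_subalgebra M F"
  by (intro finite_measure_subalgebra_is_sigma_finite)
     (simp add: finite_measure_subalgebra_def finite_measure_subalgebra_axioms_def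
        finite_measure_axioms)

lemma (in prob_space) expectation_mult_indicator_indep:
  fixes W :: "'a \<Rightarrow> real"
  assumes indep: "indep_set (sets G) (sets H)"
    and G: "subalgebra M G" and H: "subalgebra M H"
    and W: "integrable M W" "W \<in> borel_measurable G" and b: "b \<in> sets H"
  shows "expectation (\<lambda>x. W x * indicator b x) = expectation W * prob b"
proof -
  have bM: "b \<in> sets M"
    using b H by (auto simp: subalgebra_def)
  have ind: "(indicator b :: 'a \<Rightarrow> real) \<in> borel_measurable H"
    using b by simp
  have generated: "sigma_sets (space M) {f -` A \<inter> space M |A. A \<in> sets borel} \<subseteq> sets N"
    if "subalgebra M N" "f \<in> borel_measurable N" for f :: "'a \<Rightarrow> real" and N
  proof -
    have space: "space N = space M"
      using that(1) by (simp add: subalgebra_def)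
    show ?thesis
      unfolding space[symmetric] using measurable_sets[OF that(2)]
      by (intro sets.sigma_sets_subset) blast
  qed
  have "indep_set (sigma_sets (space M) {W -` A \<inter> space M |A. A \<in> sets borel})
     (sigma_sets (space M) {indicator b -` A \<inter> space M |A. A \<in> sets (borel :: real measure)})"
    using indep generated[OF G W(2)] generated[OF H ind] unfolding indep_set_def
    by (elim indep_sets_mono_sets) (simp split: bool.split)
  then have "indep_var borel W borel (indicator b :: 'a \<Rightarrow> real)"
    unfolding indep_var_eq using W(1) bM by simp
  moreover have "integrable M (indicator b :: 'a \<Rightarrow> real)"
    using bM by (intro integrable_real_indicator) (simp_all add: less_top[symmetric])
  ultimately show ?thesis
    using indep_var_lebesgue_integral[OF _ W(1)] bM by simp
qed

text \<open>
  Information \<open>H\<close> that is independent of all of \<open>G\<close> does not improve the prediction of a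
  \<open>G\<close>-measurable variable, even on top of other information \<open>K\<close> from \<open>G\<close>. Independence of \<open>H\<close> from
  \<open>Z\<close> alone would not be enough: on \<open>a \<inter> b\<close> with \<open>a\<close> in \<open>K\<close> and \<open>b\<close> in \<open>H\<close>, the factor \<open>P b\<close> has to
  split off from the integrals of both \<open>Z\<close> and \<open>E (Z | K)\<close> over \<open>a \<inter> b\<close>. The sets \<open>a \<inter> b\<close> are stable
  under intersection, so Dynkin's theorem extends the equality of integrals from them to \<open>F\<close>.
\<close>

lemma (in prob_space) real_cond_exp_drop_independent:
  fixes Z :: "'a \<Rightarrow> real"
  assumes indep: "indep_set (sets G) (sets H)"
    and subalg: "subalgebra M G" "subalgebra M H" "subalgebra M F" "subalgebra G K" "subalgebra F K"
    and gen: "sets F \<subseteq> sigma_sets (space M) {a \<inter> b | a b. a \<in> sets K \<and> b \<in> sets H}"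
    and Z: "integrable M Z" "Z \<in> borel_measurable G"
  shows "AE x in M. real_cond_exp M F Z x = real_cond_exp M K Z x"
proof -
  have K: "subalgebra M K"
    using subalg(1,4) by (auto simp: subalgebra_def)
  interpret F: sigma_finite_subalgebra M F
    by (rule sigma_finite_subalgebraI) fact
  interpret K: sigma_finite_subalgebra M K
    by (rule sigma_finite_subalgebraI) fact
  let ?P = "{a \<inter> b | a b. a \<in> sets K \<and> b \<in> sets H}"
  let ?U = "real_cond_exp M K Z"
  have U: "integrable M ?U"
    by (rule K.real_cond_exp_int) fact
  have meas: "sets K \<subseteq> sets G" "sets G \<subseteq> sets M" "sets H \<subseteq> sets M" "space K = space M"
       "space H = space M" "space G = space M"
    using subalg by (auto simp: subalgebra_def)
  have UG: "?U \<in> borel_measurable G"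
    using measurable_from_subalg[OF subalg(4) borel_measurable_cond_exp] .
  have P: "Int_stable ?P" "?P \<subseteq> Pow (space M)"
  proof -
    show "Int_stable ?P"
    proof (rule Int_stableI, safe)
      fix a b a' b' assume "a \<in> sets K" "b \<in> sets H" "a' \<in> sets K" "b' \<in> sets H"
      then show "\<exists>c d. (a \<inter> b) \<inter> (a' \<inter> b') = c \<inter> d \<and> c \<in> sets K \<and> d \<in> sets H"
        by (intro exI[of _ "a \<inter> a'"] exI[of _ "b \<inter> b'"]) auto
    qed
    show "?P \<subseteq> Pow (space M)"
      using sets.sets_into_space[of _ H] meas(5) by auto
  qed
  have P_events: "sigma_sets (space M) ?P \<subseteq> sets M"
    using meas by (intro sets.sigma_sets_subset) auto
  have int: "set_integrable M A Z" "set_integrable M A ?U" if "A \<in> sets M" for A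
    unfolding set_integrable_def
    using that Z(1) U by (intro integrable_mult_indicator; simp)+
  have whole: "(LINT x|M. Z x) = (LINT x|M. ?U x)"
    using K.real_cond_exp_int(2)[OF Z(1)] ..
  have "(LINT x:A|M. Z x) = (LINT x:A|M. ?U x)" if "A \<in> sigma_sets (space M) ?P" for A
    using P that
  proof (induction rule: sigma_sets_induct_disjoint)
    case (basic A)
    then obtain a b where A: "A = a \<inter> b" and a: "a \<in> sets K" and b: "b \<in> sets H"
      by auto
    have aG: "a \<in> sets G" "a \<in> sets M"
      using a meas by auto
    have product: "(LINT x:A|M. W x) = (LINT x:a|M. W x) * prob b"
      if W: "integrable M W" "W \<in> borel_measurable G" for W :: "'a \<Rightarrow> real"
    proof -
      have "(LINT x:A|M. W x) = expectation (\<lambda>x. (indicator a x * W x) * indicator b x)"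
        by (simp add: A set_lebesgue_integral_def indicator_inter_arith ac_simps)
      also have "\<dots> = expectation (\<lambda>x. indicator a x * W x) * prob b"
        using W aG integrable_mult_indicator[OF aG(2) W(1)]
        by (intro expectation_mult_indicator_indep[OF indep subalg(1,2) _ _ b]) auto
      finally show ?thesis
        by (simp add: set_lebesgue_integral_def)
    qed
    show ?case
      using product[OF Z] product[OF U UG] K.real_cond_exp_intA[OF Z(1) a] by simp
  next
    case empty
    then show ?case by (simp add: set_lebesgue_integral_def)
  next
    case (compl A)
    then have A: "A \<in> sets M"
      using P_events by auto
    have "(LINT x:space M - A|M. W x) = (LINT x|M. W x) - (LINT x:A|M. W x)"
      if "integrable M W" for W :: "'a \<Rightarrow> real"
    proof -
      have "(LINT x:space M - A|M. W x) = (LINT x|M. W x - indicator A x *\<^sub>R W x)"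
        unfolding set_lebesgue_integral_def
        by (intro Bochner_Integration.integral_cong) (auto simp: indicator_def)
      then show ?thesis
        using that integrable_mult_indicator[OF A that] by (simp add: set_lebesgue_integral_def)
    qed
    with Z(1) U compl whole show ?case
      by simp
  next
    case (union A)
    then have A: "A n \<in> sets M" for n
      using P_events by auto
    have disj: "A m \<inter> A n = {}" if "m \<noteq> n" for m n
      using union(1) that by (auto simp: disjoint_family_on_def)
    have UN: "(\<Union>n. A n) \<in> sets M"
      using A by auto
    show ?case
      using union(3) lebesgue_integral_countable_add[OF A disj int(1)[OF UN]]
        lebesgue_integral_countable_add[OF A disj int(2)[OF UN]] by simp
  qed
  with gen show ?thesis
    using Z(1) U measurable_from_subalg[OF subalg(5) borel_measurable_cond_exp]
    by (intro F.real_cond_exp_charact) auto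
qed

lemma (in prob_space) square_integrable_real_cond_exp:
  fixes Z :: "'a \<Rightarrow> real"
  assumes F: "subalgebra M F" and Z: "Z \<in> borel_measurable M" "integrable M (\<lambda>x. (Z x)\<^sup>2)"
  shows "integrable M (\<lambda>x. (real_cond_exp M F Z x)\<^sup>2)"
    and "expectation (\<lambda>x. (real_cond_exp M F Z x)\<^sup>2) \<le> expectation (\<lambda>x. (Z x)\<^sup>2)"
proof -
  interpret F: sigma_finite_subalgebra M F
    by (rule sigma_finite_subalgebraI) fact
  have int: "integrable M Z"
    using Z by (rule square_integrable_imp_integrable)
  have conv: "convex_on UNIV (\<lambda>x :: real. x\<^sup>2)"
    by (rule convex_power2)
  show int2: "integrable M (\<lambda>x. (real_cond_exp M F Z x)\<^sup>2)"
    using F.integrable_convex_cond_exp[OF int _ _ Z(2) conv] by auto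
  have le: "AE x in M. (real_cond_exp M F Z x)\<^sup>2 \<le> real_cond_exp M F (\<lambda>x. (Z x)\<^sup>2) x"
    using F.real_cond_exp_jensens_inequality(2)[OF int _ _ Z(2) conv] by auto
  show "expectation (\<lambda>x. (real_cond_exp M F Z x)\<^sup>2) \<le> expectation (\<lambda>x. (Z x)\<^sup>2)"
    using integral_mono_AE[OF int2 F.real_cond_exp_int(1)[OF Z(2)] le] F.real_cond_exp_int(2)[OF Z(2)]
    by simp
qed

text \<open>
  Jensen's inequality for the second moments gives this, since conditioning preserves the mean.
\<close>

lemma (in prob_space) variance_real_cond_exp_le:
  fixes Z :: "'a \<Rightarrow> real"
  assumes F: "subalgebra M F" and Z: "Z \<in> borel_measurable M" "integrable M (\<lambda>x. (Z x)\<^sup>2)"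
  shows "variance (real_cond_exp M F Z) \<le> variance Z"
proof -
  interpret F: sigma_finite_subalgebra M F
    by (rule sigma_finite_subalgebraI) fact
  have int: "integrable M Z"
    using Z by (rule square_integrable_imp_integrable)
  have "variance (real_cond_exp M F Z) =
      expectation (\<lambda>x. (real_cond_exp M F Z x)\<^sup>2) - (expectation (real_cond_exp M F Z))\<^sup>2"
    using square_integrable_real_cond_exp(1)[OF assms] F.real_cond_exp_int(1)[OF int]
    by (rule variance_eq[rotated])
  then show ?thesis
    unfolding variance_eq[OF int Z(2)] F.real_cond_exp_int(2)[OF int]
    using square_integrable_real_cond_exp(2)[OF assms] by linarith
qed

lemma variance_cong_AE:
  fixes Z W :: "'a \<Rightarrow> real"
  assumes "Z \<in> borel_measurable M" "W \<in> borel_measurable M" "AE x in M. Z x = W x"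
  shows "prob_space.variance M Z = prob_space.variance M W"
proof -
  have "integral\<^sup>L M Z = integral\<^sup>L M W"
    using assms by (intro integral_cong_AE) auto
  moreover have "(LINT x|M. (Z x - c)\<^sup>2) = (LINT x|M. (W x - c)\<^sup>2)" for c
    using assms by (intro integral_cong_AE) auto
  ultimately show ?thesis
    by simp
qed

lemma (in prob_space) integrable_mult_square_integrable:
  fixes U V :: "'a \<Rightarrow> real"
  assumes "U \<in> borel_measurable M" "V \<in> borel_measurable M"
    and "integrable M (\<lambda>x. (U x)\<^sup>2)" "integrable M (\<lambda>x. (V x)\<^sup>2)"
  shows "integrable M (\<lambda>x. U x * V x)"
proof (rule Bochner_Integration.integrable_bound)
  show "integrable M (\<lambda>x. (U x)\<^sup>2 + (V x)\<^sup>2)"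
    using assms by simp
  have "\<bar>u * v\<bar> \<le> \<bar>u\<^sup>2 + v\<^sup>2\<bar>" for u v :: real
  proof -
    have "0 \<le> \<bar>u\<bar> * \<bar>v\<bar>" "2 * (\<bar>u\<bar> * \<bar>v\<bar>) \<le> u\<^sup>2 + v\<^sup>2"
      using sum_squares_bound[of "\<bar>u\<bar>" "\<bar>v\<bar>"] by simp_all
    then show ?thesis
      unfolding abs_mult by linarith
  qed
  then show "AE x in M. norm (U x * V x) \<le> norm ((U x)\<^sup>2 + (V x)\<^sup>2)"
    by simp
qed (use assms in simp)

lemma (in prob_space) variance_sum_uncorrelated:
  fixes U :: "'b \<Rightarrow> 'a \<Rightarrow> real"
  assumes fin: "finite W" and meas: "\<And>w. w \<in> W \<Longrightarrow> U w \<in> borel_measurable M"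
    and sq: "\<And>w. w \<in> W \<Longrightarrow> integrable M (\<lambda>x. (U w x)\<^sup>2)"
    and uncor: "\<And>w w'. w \<in> W \<Longrightarrow> w' \<in> W \<Longrightarrow> w \<noteq> w' \<Longrightarrow>
      expectation (\<lambda>x. U w x * U w' x) = expectation (U w) * expectation (U w')"
  shows "variance (\<lambda>x. \<Sum>w\<in>W. U w x) = (\<Sum>w\<in>W. variance (U w))"
proof -
  have int: "integrable M (U w)" if "w \<in> W" for w
    using meas[OF that] sq[OF that] by (rule square_integrable_imp_integrable)
  have prod: "integrable M (\<lambda>x. U w x * U w' x)" if "w \<in> W" "w' \<in> W" for w w'
    using that meas sq by (intro integrable_mult_square_integrable) auto
  define m where "m w = expectation (U w)" for w
  have mean: "expectation (\<lambda>x. \<Sum>w\<in>W. U w x) = (\<Sum>w\<in>W. m w)"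
    using int by (simp add: m_def)
  have cov: "expectation (\<lambda>x. (U w x - m w) * (U w' x - m w')) = (if w = w' then variance (U w) else 0)"
    if w: "w \<in> W" "w' \<in> W" for w w'
  proof (cases "w = w'")
    case False
    have "expectation (\<lambda>x. (U w x - m w) * (U w' x - m w')) =
      expectation (\<lambda>x. U w x * U w' x - m w' * U w x - m w * U w' x + m w * m w')"
      by (simp add: algebra_simps)
    also have "\<dots> = 0"
      using w int prod[OF w] uncor[OF w False] by (simp add: prob_space m_def)
    finally show ?thesis
      using False by simp
  qed (simp add: m_def power2_eq_square)
  have intc: "integrable M (\<lambda>x. (U w x - m w) * (U w' x - m w'))" if w: "w \<in> W" "w' \<in> W" for w w'
    using w int prod[OF w] by (simp add: algebra_simps)
  have "variance (\<lambda>x. \<Sum>w\<in>W. U w x) = expectation (\<lambda>x. \<Sum>w\<in>W. \<Sum>w'\<in>W. (U w x - m w) * (U w' x - m w'))"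
    unfolding mean by (simp add: power2_eq_square sum_product flip: sum_subtractf)
  also have "\<dots> = (\<Sum>w\<in>W. \<Sum>w'\<in>W. if w = w' then variance (U w) else 0)"
    using intc by (simp add: cov)
  also have "\<dots> = (\<Sum>w\<in>W. variance (U w))"
    using fin by simp
  finally show ?thesis .
qed

section \<open>Sigma-algebras generated by subvectors\<close>

lemma space_sigma_subvec [simp]: "space (sigma_subvec M E X u) = space M"
  by (simp add: sigma_subvec_def)

lemma sets_sigma_subvec_subset:
  assumes "space N = space M" "\<And>i. i \<in> u \<Longrightarrow> X i \<in> measurable N (E i)"
  shows "sets (sigma_subvec M E X u) \<subseteq> sets N"
  unfolding sigma_subvec_def subvec_def
  using assms by (intro sets_image_in_sets measurable_restrict) auto

lemma measurable_subvec:
  assumes "\<And>i. i \<in> u \<Longrightarrow> X i \<in> measurable M (E i)"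
  shows "subvec X u \<in> measurable (sigma_subvec M E X u) (PiM u E)"
  unfolding sigma_subvec_def
  using assms[THEN measurable_space]
  by (intro measurable_vimage_algebra1) (auto simp: subvec_def space_PiM)

lemma measurable_component_sigma_subvec:
  assumes "\<And>i. i \<in> u \<Longrightarrow> X i \<in> measurable M (E i)" "i \<in> u"
  shows "X i \<in> measurable (sigma_subvec M E X u) (E i)"
  using measurable_compose[OF measurable_subvec[where X = X and u = u, OF assms(1)]
      measurable_component_singleton[OF assms(2)]] assms(2)
  by (simp add: subvec_def)

lemma subalgebra_sigma_subvec:
  assumes "\<And>i. i \<in> u \<Longrightarrow> X i \<in> measurable M (E i)"
  shows "subalgebra M (sigma_subvec M E X u)"
  using sets_sigma_subvec_subset[OF refl assms] by (simp add: subalgebra_def)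

lemma sigma_subvec_mono:
  assumes "\<And>i. i \<in> u \<Longrightarrow> X i \<in> measurable M (E i)" "v \<subseteq> u"
  shows "subalgebra (sigma_subvec M E X u) (sigma_subvec M E X v)"
proof -
  have "sets (sigma_subvec M E X v) \<subseteq> sets (sigma_subvec M E X u)"
    using assms
    by (intro sets_sigma_subvec_subset measurable_component_sigma_subvec) auto
  then show ?thesis
    by (simp add: subalgebra_def)
qed

section \<open>Independent groups of inputs\<close>

text \<open>
  Only the groups are independent of each other; within a group the dependence between the inputs is
  arbitrary.
\<close>

locale independent_groups = prob_space M for M :: "'a measure" +
  fixes E :: "nat \<Rightarrow> 'e measure" and X :: "nat \<Rightarrow> 'a \<Rightarrow> 'e"
    and C :: "nat \<Rightarrow> nat set" and J :: "nat set"
  assumes measurable_input: "\<And>i. i \<in> (\<Union>j\<in>J. C j) \<Longrightarrow> X i \<in> measurable M (E i)"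
    and indep_groups: "indep_vars (group_space C E) (group_vec C X) J"
begin

abbreviation "\<A> w \<equiv> sigma_subvec M (group_space C E) (group_vec C X) w"

lemma measurable_group_vec:
  assumes "j \<in> J"
  shows "group_vec C X j \<in> measurable M (group_space C E j)"
  using indep_groups assms by (auto simp: indep_vars_def)

lemma subalgebra_groups: "w \<subseteq> J \<Longrightarrow> subalgebra M (\<A> w)"
  by (intro subalgebra_sigma_subvec measurable_group_vec) auto

lemma sigma_subvec_subset_groups:
  assumes w: "w \<subseteq> J" and u: "u \<subseteq> (\<Union>j\<in>w. C j)"
  shows "subalgebra (\<A> w) (sigma_subvec M E X u)"
proof -
  have "X i \<in> measurable (\<A> w) (E i)" if i: "i \<in> u" for i
  proof -
    obtain j where j: "j \<in> w" "i \<in> C j"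
      using i u by auto
    have "group_vec C X j \<in> measurable (\<A> w) (PiM (C j) E)"
      using measurable_component_sigma_subvec[of w "group_vec C X" M "group_space C E" j]
        measurable_group_vec w j(1) by (auto simp: group_space_def)
    from measurable_compose[OF this measurable_component_singleton[OF j(2)]] show ?thesis
      using j(2) by (simp add: group_vec_def subvec_def)
  qed
  then have "sets (sigma_subvec M E X u) \<subseteq> sets (\<A> w)"
    by (intro sets_sigma_subvec_subset) auto
  then show ?thesis
    by (simp add: subalgebra_def)
qed

lemma indep_set_groups:
  assumes "w \<subseteq> J" "z \<subseteq> J" "w \<inter> z = {}"
  shows "indep_set (sets (\<A> w)) (sets (\<A> z))"
proof -
  have "indep_var (PiM w (group_space C E)) (subvec (group_vec C X) w)
      (PiM z (group_space C E)) (subvec (group_vec C X) z)"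
    using indep_var_restrict[OF indep_groups assms(3,1,2)] by (simp add: subvec_def[abs_def])
  then show ?thesis
    by (simp add: indep_var_eq sigma_subvec_def sets_vimage_algebra)
qed

text \<open>
  Inputs outside the groups \<open>w\<close> are independent of \<open>A\<^sub>w\<close>, hence irrelevant for the prediction of a
  function of \<open>A\<^sub>w\<close>. In the game \<open>u \<mapsto> Var (E (Z | X\<^sub>u))\<close> they are therefore dummy players.
\<close>

lemma cond_exp_given_restrict_groups:
  assumes w: "w \<subseteq> J" and u: "u \<subseteq> (\<Union>j\<in>J. C j)"
    and Z: "integrable M Z" "Z \<in> borel_measurable (\<A> w)"
  shows "AE x in M. cond_exp_given M E X u Z x = cond_exp_given M E X (u \<inter> (\<Union>j\<in>w. C j)) Z x"
proof -
  let ?v = "u \<inter> (\<Union>j\<in>w. C j)" and ?F = "sigma_subvec M E X"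
  let ?P = "{a \<inter> b |a b. a \<in> sets (?F ?v) \<and> b \<in> sets (\<A> (J - w))}"
  have X: "X i \<in> measurable M (E i)" if "i \<in> u" for i
    using that u by (intro measurable_input) auto
  have events: "sets (?F ?v) \<subseteq> Pow (space M)" "sets (\<A> (J - w)) \<subseteq> Pow (space M)"
    using sets.space_closed[of "?F ?v"] sets.space_closed[of "\<A> (J - w)"] by auto
  then have P: "?P \<subseteq> Pow (space M)"
    by auto
  \<comment> \<open>\<open>u\<close> splits into the inputs \<open>?v\<close> and inputs from the groups \<open>J - w\<close>, and both contribute to \<open>?P\<close>
    because each factor of \<open>a \<inter> b\<close> may be the whole space.\<close>
  have left: "a \<in> ?P" if "a \<in> sets (?F ?v)" for a
    using that events(1) sets.top[of "\<A> (J - w)"] by (intro CollectI exI[of _ a] exI[of _ "space M"]) auto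
  have right: "b \<in> ?P" if "b \<in> sets (\<A> (J - w))" for b
    using that events(2) sets.top[of "?F ?v"] by (intro CollectI exI[of _ "space M"] exI[of _ b]) auto
  have "sets (?F u) \<subseteq> sets (sigma (space M) ?P)"
  proof (rule sets_sigma_subvec_subset)
    show "space (sigma (space M) ?P) = space M"
      using P by simp
    fix i assume i: "i \<in> u"
    have "\<exists>N. X i \<in> measurable N (E i) \<and> space N = space M \<and> sets N \<subseteq> ?P"
    proof (cases "i \<in> ?v")
      case True
      then show ?thesis
        using X left by (intro exI[of _ "?F ?v"]) (auto intro!: measurable_component_sigma_subvec)
    next
      case False
      then have "i \<in> (\<Union>j\<in>J - w. C j)"
        using i u by blast
      then have "subalgebra (\<A> (J - w)) (?F {i})"
        by (intro sigma_subvec_subset_groups) auto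
      moreover have "X i \<in> measurable (?F {i}) (E i)"
        using X[OF i] by (intro measurable_component_sigma_subvec) auto
      ultimately show ?thesis
        using right by (intro exI[of _ "\<A> (J - w)"]) (auto intro: measurable_from_subalg)
    qed
    then obtain N where N: "X i \<in> measurable N (E i)" "space N = space M" "sets N \<subseteq> ?P"
      by blast
    then show "X i \<in> measurable (sigma (space M) ?P) (E i)"
      using P by (intro measurable_from_subalg[OF _ N(1)]) (auto simp: subalgebra_def)
  qed
  then have "sets (?F u) \<subseteq> sigma_sets (space M) ?P"
    using P by simp
  then show ?thesis
    unfolding cond_exp_given_def
  proof (intro real_cond_exp_drop_independent[OF indep_set_groups[of w "J - w"]])
    show "subalgebra M (\<A> w)" "subalgebra M (\<A> (J - w))"
      using w by (intro subalgebra_groups; blast)+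
    show "subalgebra M (?F u)"
      using X by (rule subalgebra_sigma_subvec)
    show "subalgebra (\<A> w) (?F ?v)"
      using w by (intro sigma_subvec_subset_groups) auto
    show "subalgebra (?F u) (?F ?v)"
      using X by (intro sigma_subvec_mono) auto
  qed (use Z w in auto)
qed

lemma cond_exp_variance_restrict_groups:
  assumes "w \<subseteq> J" "u \<subseteq> (\<Union>j\<in>J. C j)" "integrable M Z" "Z \<in> borel_measurable (\<A> w)"
  shows "cond_exp_variance M E X Z u = cond_exp_variance M E X Z (u \<inter> (\<Union>j\<in>w. C j))"
  unfolding cond_exp_variance_def
  using cond_exp_given_restrict_groups[OF assms]
  by (intro variance_cong_AE) (simp_all add: cond_exp_given_def borel_measurable_cond_exp2)

text \<open>
  The Hoeffding components are orthogonal, and conditioning on an arbitrary set of inputs, which may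
  cut through the groups, preserves this. By \<open>cond_exp_given_restrict_groups\<close>, \<open>E (Z' | X\<^sub>u)\<close> is
  a function both of \<open>X\<^sub>u\<close> and of \<open>A\<^sub>w\<^sub>'\<close>. The first fact allows replacing \<open>E (Z | X\<^sub>u)\<close> by \<open>Z\<close> in the
  expectation of the product, the second allows replacing \<open>Z\<close> by its conditional expectation
  given \<open>A\<^sub>w\<^sub>'\<close>, which is zero.
\<close>

lemma expectation_cond_exp_orthogonal:
  assumes w: "w \<subseteq> J" "w' \<subseteq> J" and u: "u \<subseteq> (\<Union>j\<in>J. C j)"
    and Z: "Z \<in> borel_measurable (\<A> w)" "integrable M (\<lambda>x. (Z x)\<^sup>2)"
    and Z': "Z' \<in> borel_measurable (\<A> w')" "integrable M (\<lambda>x. (Z' x)\<^sup>2)"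
    and null: "AE x in M. cond_exp_given M (group_space C E) (group_vec C X) w' Z x = 0"
  shows "expectation (\<lambda>x. cond_exp_given M E X u Z x * cond_exp_given M E X u Z' x) = 0"
proof -
  let ?F = "sigma_subvec M E X"
  let ?v = "u \<inter> (\<Union>j\<in>w'. C j)"
  let ?U = "cond_exp_given M E X u Z"
  let ?U' = "cond_exp_given M E X u Z'" and ?V' = "cond_exp_given M E X ?v Z'"
  have X: "X i \<in> measurable M (E i)" if "i \<in> u" for i
    using that u by (intro measurable_input) auto
  have F: "subalgebra M (?F u)" "subalgebra M (?F ?v)"
    using X by (auto intro!: subalgebra_sigma_subvec)
  have Zm: "Z \<in> borel_measurable M" "Z' \<in> borel_measurable M"
    using measurable_from_subalg[OF subalgebra_groups] w Z(1) Z'(1) by auto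
  have intZ': "integrable M Z'"
    using Zm(2) Z'(2) by (rule square_integrable_imp_integrable)
  interpret F: sigma_finite_subalgebra M "?F u"
    by (rule sigma_finite_subalgebraI) fact
  interpret A: sigma_finite_subalgebra M "\<A> w'"
    using w by (intro sigma_finite_subalgebraI subalgebra_groups)
  have V'F: "?V' \<in> borel_measurable (?F ?v)"
    by (simp add: cond_exp_given_def)
  have V'u: "?V' \<in> borel_measurable (?F u)"
    using X by (intro measurable_from_subalg[OF sigma_subvec_mono V'F]) auto
  have V'A: "?V' \<in> borel_measurable (\<A> w')"
    using w by (intro measurable_from_subalg[OF sigma_subvec_subset_groups V'F]) auto
  have intVZ: "integrable M (\<lambda>x. ?V' x * Z x)"
    using square_integrable_real_cond_exp(1)[OF F(2) Zm(2) Z'(2)] Zm Z(2)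
    by (intro integrable_mult_square_integrable)
       (simp_all add: cond_exp_given_def borel_measurable_cond_exp2)
  have "expectation (\<lambda>x. ?U x * ?U' x) = expectation (\<lambda>x. ?V' x * ?U x)"
  proof (rule integral_cong_AE)
    show "AE x in M. ?U x * ?U' x = ?V' x * ?U x"
      using cond_exp_given_restrict_groups[OF w(2) u intZ' Z'(1)] by eventually_elim simp
  qed (simp_all add: cond_exp_given_def borel_measurable_cond_exp2)
  also have "\<dots> = expectation (\<lambda>x. ?V' x * Z x)"
    unfolding cond_exp_given_def[of M E X u]
    using intVZ V'u Zm by (intro F.real_cond_exp_intg(2))
  also have "\<dots> = expectation (\<lambda>x. ?V' x * real_cond_exp M (\<A> w') Z x)"
    using intVZ V'A Zm by (intro A.real_cond_exp_intg(2)[symmetric])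
  also have "\<dots> = expectation (\<lambda>x. 0)"
  proof (rule integral_cong_AE)
    show "AE x in M. ?V' x * real_cond_exp M (\<A> w') Z x = 0"
      using null unfolding cond_exp_given_def by eventually_elim simp
  qed (simp_all add: cond_exp_given_def borel_measurable_cond_exp2)
  finally show ?thesis
    by simp
qed

text \<open>
  The variance of a conditional expectation decomposes along the Hoeffding components, because their
  conditional expectations are uncorrelated: of two different index sets, one is not contained in
  the other, so that orthogonality applies to them in one of the two orders.
\<close>

lemma cond_exp_variance_hoeffding_sum:
  fixes Z :: "nat set \<Rightarrow> 'a \<Rightarrow> real"
  assumes fin: "finite J" and u: "u \<subseteq> (\<Union>j\<in>J. C j)"
    and Z: "\<And>w. w \<subseteq> J \<Longrightarrow> Z w \<in> borel_measurable (\<A> w)"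
      "\<And>w. w \<subseteq> J \<Longrightarrow> integrable M (\<lambda>x. (Z w x)\<^sup>2)"
    and null: "\<And>w z. w \<subseteq> J \<Longrightarrow> z \<subseteq> J \<Longrightarrow> \<not> w \<subseteq> z \<Longrightarrow>
      AE x in M. cond_exp_given M (group_space C E) (group_vec C X) z (Z w) x = 0"
    and Y: "Y \<in> borel_measurable M" "AE x in M. Y x = (\<Sum>w\<in>Pow J. Z w x)"
  shows "cond_exp_variance M E X Y u = (\<Sum>w\<in>Pow J. cond_exp_variance M E X (Z w) u)"
proof -
  let ?F = "sigma_subvec M E X u"
  let ?U = "\<lambda>w. cond_exp_given M E X u (Z w)"
  have F: "subalgebra M ?F"
    using u measurable_input by (intro subalgebra_sigma_subvec) auto
  interpret F: sigma_finite_subalgebra M ?F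
    by (rule sigma_finite_subalgebraI) fact
  have Zm: "Z w \<in> borel_measurable M" if "w \<subseteq> J" for w
    using measurable_from_subalg[OF subalgebra_groups Z(1)] that by simp
  have Zi: "integrable M (Z w)" if "w \<subseteq> J" for w
    using Zm[OF that] Z(2)[OF that] by (rule square_integrable_imp_integrable)
  have Um: "?U w \<in> borel_measurable M" for w
    by (simp add: cond_exp_given_def borel_measurable_cond_exp2)
  have sum: "AE x in M. cond_exp_given M E X u Y x = (\<Sum>w\<in>Pow J. ?U w x)"
  proof -
    \<comment> \<open>The sum rule for conditional expectations asks for integrability at every index, also at those
      outside the index set of the sum.\<close>
    define Z0 where "Z0 w = (if w \<subseteq> J then Z w else (\<lambda>_. 0))" for w
    have "AE x in M. Y x = (\<Sum>w\<in>Pow J. Z0 w x)"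
      using Y(2) by (simp add: Z0_def)
    moreover have "Z0 w \<in> borel_measurable M" "integrable M (Z0 w)" for w
      using Zm Zi by (auto simp: Z0_def)
    ultimately have "AE x in M. real_cond_exp M ?F Y x = real_cond_exp M ?F (\<lambda>x. \<Sum>w\<in>Pow J. Z0 w x) x"
      "AE x in M. real_cond_exp M ?F (\<lambda>x. \<Sum>w\<in>Pow J. Z0 w x) x = (\<Sum>w\<in>Pow J. real_cond_exp M ?F (Z0 w) x)"
      using Y(1) by (intro F.real_cond_exp_cong F.real_cond_exp_sum; simp)+
    then show ?thesis
      unfolding cond_exp_given_def by eventually_elim (simp add: Z0_def)
  qed
  \<comment> \<open>Conditioning on no group at all is taking the mean, so all components but the constant one are
    centred.\<close>
  have mean: "expectation (?U w) = 0" if w: "w \<subseteq> J" "w \<noteq> {}" for w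
  proof -
    interpret A: sigma_finite_subalgebra M "\<A> {}"
      by (intro sigma_finite_subalgebraI subalgebra_groups) simp
    have "expectation (?U w) = expectation (Z w)"
      unfolding cond_exp_given_def by (rule F.real_cond_exp_int(2)[OF Zi[OF w(1)]])
    also have "\<dots> = expectation (real_cond_exp M (\<A> {}) (Z w))"
      by (rule A.real_cond_exp_int(2)[OF Zi[OF w(1)], symmetric])
    also have "\<dots> = expectation (\<lambda>x. 0)"
      using null[OF w(1), of "{}"] w(2)
      by (intro integral_cong_AE) (auto simp: cond_exp_given_def borel_measurable_cond_exp2)
    finally show ?thesis
      by simp
  qed
  have orth: "expectation (\<lambda>x. ?U w x * ?U w' x) = 0" if w: "w \<subseteq> J" "w' \<subseteq> J" "\<not> w \<subseteq> w'" for w w'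
    using w by (intro expectation_cond_exp_orthogonal[OF w(1,2) u] Z null)
  have uncor: "expectation (\<lambda>x. ?U w x * ?U w' x) = expectation (?U w) * expectation (?U w')"
    if w: "w \<in> Pow J" "w' \<in> Pow J" "w \<noteq> w'" for w w'
  proof -
    have "expectation (\<lambda>x. ?U w x * ?U w' x) = 0"
    proof (cases "w \<subseteq> w'")
      case False
      with w orth[of w w'] show ?thesis by auto
    next
      case True
      with w orth[of w' w] show ?thesis by (auto simp: mult.commute)
    qed
    moreover have "expectation (?U w) * expectation (?U w') = 0"
      using mean[of w] mean[of w'] w by (cases "w = {}") auto
    ultimately show ?thesis
      by simp
  qed
  have "cond_exp_variance M E X Y u = variance (\<lambda>x. \<Sum>w\<in>Pow J. ?U w x)"
    unfolding cond_exp_variance_def using Um sum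
    by (intro variance_cong_AE) (simp_all add: cond_exp_given_def borel_measurable_cond_exp2)
  also have "\<dots> = (\<Sum>w\<in>Pow J. variance (?U w))"
  proof (rule variance_sum_uncorrelated)
    show "integrable M (\<lambda>x. (?U w x)\<^sup>2)" if "w \<in> Pow J" for w
      using that Zm Z(2) F by (auto simp: cond_exp_given_def intro!: square_integrable_real_cond_exp)
  qed (use fin Um uncor in auto)
  finally show ?thesis
    by (simp add: cond_exp_variance_def)
qed

end

section \<open>Shapley effects for block-independent inputs\<close>

theorem proposition3:
  fixes M :: "'a measure"
    and E :: "nat \<Rightarrow> 'e measure"
    and X :: "nat \<Rightarrow> 'a \<Rightarrow> 'e"
    and f :: "(nat \<Rightarrow> 'e) \<Rightarrow> real"
    and Y :: "'a \<Rightarrow> real"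
    and p k i :: nat
    and C :: "nat \<Rightarrow> nat set"
    and gw :: "nat set \<Rightarrow> (nat \<Rightarrow> nat \<Rightarrow> 'e) \<Rightarrow> real"
  assumes "prob_space M"
    and "\<And>i. i \<in> {1..p} \<Longrightarrow> X i \<in> measurable M (E i)"
    and "f \<in> borel_measurable (PiM {1..p} E)"
    and "Y = (\<lambda>\<omega>. f (subvec X {1..p} \<omega>))"
    and "integrable M (\<lambda>\<omega>. (Y \<omega>)\<^sup>2)"
    and "prob_space.variance M Y \<noteq> 0"
    and "\<And>j. j \<in> {1..k} \<Longrightarrow> C j \<noteq> {}"
    and "disjoint_family_on C {1..k}"
    and "(\<Union>j\<in>{1..k}. C j) = {1..p}"
    and "prob_space.indep_vars M (group_space C E) (group_vec C X) {1..k}"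
    and "hoeffding_decomposition M {1..k} (group_space C E) (group_vec C X) (group_fun p k C f) gw"
    and "i \<in> {1..p}"
  shows "shapley_effect M E X {1..p} Y i =
    (\<Sum>w\<in>{w. w \<subseteq> {1..k} \<and> group_index k C i \<in> w}.
       sobol_index M Y (\<lambda>\<omega>. gw w (subvec (group_vec C X) w \<omega>)) *
       shapley_effect M E X (\<Union>j\<in>w. C j) (\<lambda>\<omega>. gw w (subvec (group_vec C X) w \<omega>)) i)"
proof -
  interpret prob_space M by fact
  note X = assms(2) and C = assms(7-9) and hoeffding = assms(11)
  let ?J = "{1..k}" and ?A = "group_vec C X" and ?G = "group_space C E"
  define Z where "Z w = (\<lambda>\<omega>. gw w (subvec ?A w \<omega>))" for w
  let ?V = "cond_exp_variance M E X"
  interpret independent_groups M E X C ?J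
    using X C(3) assms(10) by unfold_locales auto
  have Z_meas: "Z w \<in> borel_measurable (\<A> w)" if "w \<subseteq> ?J" for w
  proof -
    have "gw w \<in> borel_measurable (PiM w ?G)"
      using hoeffding that by (simp add: hoeffding_decomposition_def)
    with that show ?thesis
      unfolding Z_def
      by (intro measurable_compose[OF measurable_subvec] measurable_group_vec) auto
  qed
  have Z_events: "Z w \<in> borel_measurable M" if "w \<subseteq> ?J" for w
    using measurable_from_subalg[OF subalgebra_groups Z_meas] that by simp
  have Z_sq: "integrable M (\<lambda>x. (Z w x)\<^sup>2)" if "w \<subseteq> ?J" for w
    using hoeffding that by (simp add: hoeffding_decomposition_def Z_def)
  have Z_int: "integrable M (Z w)" if "w \<subseteq> ?J" for w
    using Z_events[OF that] Z_sq[OF that] by (rule square_integrable_imp_integrable)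
  have Z_null: "AE x in M. cond_exp_given M ?G ?A z (Z w) x = 0"
    if "w \<subseteq> ?J" "z \<subseteq> ?J" "\<not> w \<subseteq> z" for w z
    using hoeffding that by (simp add: hoeffding_decomposition_def Z_def)
  have Y_sum: "AE x in M. Y x = (\<Sum>w\<in>Pow ?J. Z w x)"
    using hoeffding
    by (simp add: hoeffding_decomposition_def Z_def assms(4) group_fun_group_vec[OF C(2,3)]
        del: One_nat_def)
  have Y_meas: "Y \<in> borel_measurable M"
  proof -
    have "subvec X {1..p} \<in> measurable M (PiM {1..p} E)"
      unfolding subvec_def[abs_def] using X by (intro measurable_restrict)
    then show ?thesis
      unfolding assms(4) using assms(3) by (rule measurable_compose)
  qed
  have V_sum: "?V Y u = (\<Sum>w\<in>Pow ?J. ?V (Z w) u)" if "u \<subseteq> {1..p}" for u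
    using that C(3)
    by (intro cond_exp_variance_hoeffding_sum Z_meas Z_sq Z_null Y_meas Y_sum) auto
  have V_restrict: "?V (Z w) u = ?V (Z w) (u \<inter> (\<Union>j\<in>w. C j))" if "w \<subseteq> ?J" "u \<subseteq> {1..p}" for w u
    using that C(3) by (intro cond_exp_variance_restrict_groups Z_int Z_meas) auto
  obtain j where j: "j \<in> ?J" "i \<in> C j"
    using assms(12) C(3) by blast
  have ji: "group_index k C i = j"
    using C(2) j by (rule group_index_eq)
  have i_iff: "i \<in> (\<Union>l\<in>w. C l) \<longleftrightarrow> j \<in> w" if "w \<subseteq> ?J" for w
    using that group_index_eq[OF C(2), of _ i] ji j(2) by blast
  have other_groups: "shapley_value {1..p} (?V (Z w)) i = 0" if w: "w \<subseteq> ?J" "j \<notin> w" for w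
  proof (rule shapley_value_dummy)
    fix u assume u: "u \<subseteq> {1..p} - {i}"
    have "(u \<union> {i}) \<inter> (\<Union>l\<in>w. C l) = u \<inter> (\<Union>l\<in>w. C l)"
      using i_iff[OF w(1)] w(2) by blast
    moreover have "u \<subseteq> {1..p}" "u \<union> {i} \<subseteq> {1..p}"
      using u assms(12) by auto
    ultimately show "?V (Z w) (u \<union> {i}) = ?V (Z w) u"
      using V_restrict[OF w(1), of u] V_restrict[OF w(1), of "u \<union> {i}"] by simp
  qed
  have own_groups: "shapley_value {1..p} (?V (Z w)) i / variance Y =
      sobol_index M Y (Z w) * shapley_effect M E X (\<Union>l\<in>w. C l) (Z w) i"
    if w: "w \<subseteq> ?J" "j \<in> w" for w
  proof -
    have sub: "(\<Union>l\<in>w. C l) \<subseteq> {1..p}"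
      using w(1) C(3) by blast
    have "shapley_value {1..p} (?V (Z w)) i = shapley_value (\<Union>l\<in>w. C l) (?V (Z w)) i"
      using i_iff[OF w(1)] w(2) sub V_restrict[OF w(1)]
      by (intro shapley_value_carrier) auto
    \<comment> \<open>A component of variance zero contributes nothing to the Shapley effect of \<open>Y\<close>, in accordance with
      the value \<open>0\<close> of the product on the right-hand side.\<close>
    moreover have "shapley_value {1..p} (?V (Z w)) i = 0" if var: "variance (Z w) = 0"
    proof (rule shapley_value_dummy)
      have zero: "?V (Z w) u = 0" if "u \<subseteq> {1..p}" for u
      proof -
        have "subalgebra M (sigma_subvec M E X u)"
          using that X by (intro subalgebra_sigma_subvec) auto
        then have "?V (Z w) u \<le> variance (Z w)"
          unfolding cond_exp_variance_def cond_exp_given_def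
          using Z_events[OF w(1)] Z_sq[OF w(1)] by (rule variance_real_cond_exp_le)
        moreover have "0 \<le> ?V (Z w) u"
          unfolding cond_exp_variance_def by (rule variance_positive)
        ultimately show ?thesis
          using var by simp
      qed
      show "?V (Z w) (u \<union> {i}) = ?V (Z w) u" if "u \<subseteq> {1..p} - {i}" for u
      proof -
        have "u \<subseteq> {1..p}" "u \<union> {i} \<subseteq> {1..p}"
          using that assms(12) by auto
        then show ?thesis
          using zero by simp
      qed
    qed
    ultimately show ?thesis
      by (cases "variance (Z w) = 0") (simp_all add: sobol_index_def shapley_effect_eq_shapley_value)
  qed
  have "shapley_effect M E X {1..p} Y i =
      shapley_value {1..p} (\<lambda>u. \<Sum>w\<in>Pow ?J. ?V (Z w) u) i / variance Y"
    unfolding shapley_effect_eq_shapley_value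
    by (simp only: shapley_value_cong[OF assms(12) V_sum])
  also have "\<dots> = (\<Sum>w\<in>Pow ?J. shapley_value {1..p} (?V (Z w)) i / variance Y)"
    by (simp only: shapley_value_sum sum_divide_distrib)
  also have "\<dots> = (\<Sum>w\<in>{w. w \<subseteq> ?J \<and> j \<in> w}. shapley_value {1..p} (?V (Z w)) i / variance Y)"
    using other_groups by (intro sum.mono_neutral_right) auto
  also have "\<dots> = (\<Sum>w\<in>{w. w \<subseteq> ?J \<and> group_index k C i \<in> w}.
      sobol_index M Y (Z w) * shapley_effect M E X (\<Union>l\<in>w. C l) (Z w) i)"
    unfolding ji using own_groups by (intro sum.cong) auto
  finally show ?thesis
    unfolding Z_def .
qed

end
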